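(* Let $\mathcal S,\mathcal A$ be finite nonempty sets and $\lambda>0$. Consider two agents solving entropy-regularized MDPs on the same state and action spaces, with discount factors $\gamma,\tilde\gamma\in[0,1)$ and transition kernels $\mathcal T,\tilde{\mathcal T}$ respectively, and facing the same reward function. Suppose the pair $(\gamma,\mathcal T),(\tilde\gamma,\tilde{\mathcal T})$ is value-distinguishing, and let $\pi,\tilde\pi$ be the observed policies of the two agents. Then a reward function consistent with both agents' policies either does not exist or is identified up to addition of a constant. That is, if $f_1,f_2:\mathcal S\times\mathcal A\to\mathbb R$ are two reward functions such that for each $i\in\{1,2\}$ the policy $\pi$ is the entropy-regularized optimal policy of $(\mathcal S,\mathcal A,\mathcal T,f_i,\gamma,\lambda)$ and $\tilde\pi$ is the entropy-regularized optimal policy of $(\mathcal S,\mathcal A,\tilde{\mathcal T},f_i,\tilde\gamma,\lambda)$, then $f_1-f_2$ is constant on $\mathcal S\times\mathcal A$.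
   Context: Value-distinguishing: the pair $(\gamma,\mathcal T),(\tilde\gamma,\tilde{\mathcal T})$ is value-distinguishing if, for functions $w,\tilde w:\mathcal S\to\mathbb R$, the statement $$w(s)-\gamma\sum_{s'\in\mathcal S}\mathcal T(s'|s,a)w(s')=\tilde w(s)-\tilde\gamma\sum_{s'\in\mathcal S}\tilde{\mathcal T}(s'|s,a)\tilde w(s')\quad\text{for all }a\in\mathcal A,\ s\in\mathcal S$$ implies that at least one of $w$ and $\tilde w$ is a constant function. Entropy-regularized MDP $(\mathcal S,\mathcal A,\mathcal T,f,\gamma,\lambda)$: policies are maps $\pi:\mathcal S\to\mathcal P(\mathcal A)$ (probability distributions on $\mathcal A$); under $\mathbb E^\pi_s$, $S_0=s$, $A_t\sim\pi(\cdot|S_t)$, $S_{t+1}\sim\mathcal T(\cdot|S_t,A_t)$. The optimal value is $V^*_\lambda(s)=\max_\pi\mathbb E^\pi_s\big[\sum_{t\ge0}\gamma^t(f(S_t,A_t)-\lambda\log\pi(A_t|S_t))\big]$. Standard facts: $V^*_\lambda(s)=\lambda\log\sum_a\exp(Q^*_\lambda(s,a)/\lambda)$ with $Q^*_\lambda(s,a)=f(s,a)+\gamma\sum_{s'}\mathcal T(s'|s,a)V^*_\lambda(s')$, and the entropy-regularized optimal policy is $\pi^*_\lambda(a|s)=\exp\big((Q^*_\lambda(s,a)-V^*_\lambda(s))/\lambda\big)$. *)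

theory Defs
  imports "HOL-Probability.Probability"
begin

text \<open>States and actions range over finite types; a transition kernel has type
  \<open>'s \<Rightarrow> 'a \<Rightarrow> 's pmf\<close>, with \<open>pmf (T s a) s'\<close> for $T(s'|s,a)$, and a policy has type
  \<open>'s \<Rightarrow> 'a pmf\<close>.\<close>

definition value_distinguishing ::
  "real \<Rightarrow> ('s::finite \<Rightarrow> 'a::finite \<Rightarrow> 's pmf) \<Rightarrow> real \<Rightarrow> ('s \<Rightarrow> 'a \<Rightarrow> 's pmf) \<Rightarrow> bool" where
  "value_distinguishing \<gamma> T \<gamma>' T' \<longleftrightarrow>
     (\<forall>w w' :: 's \<Rightarrow> real.
        (\<forall>a s. w s - \<gamma> * (\<Sum>s'\<in>UNIV. pmf (T s a) s' * w s')
             = w' s - \<gamma>' * (\<Sum>s'\<in>UNIV. pmf (T' s a) s' * w' s'))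
        \<longrightarrow> w constant_on UNIV \<or> w' constant_on UNIV)"

text \<open>The conditional law of $(S_t, A_t)$ given the history \<open>\<omega> 0, \<dots>, \<omega> (t - 1)\<close> of
  state-action pairs, with $S_0 = s$.\<close>

definition step_kernel ::
  "('s::finite \<Rightarrow> 'a::finite \<Rightarrow> 's pmf) \<Rightarrow> ('s \<Rightarrow> 'a pmf) \<Rightarrow> 's \<Rightarrow>
     nat \<Rightarrow> (nat \<Rightarrow> 's \<times> 'a) \<Rightarrow> ('s \<times> 'a) measure" where
  "step_kernel T \<pi> s t \<omega> = measure_pmf
     (bind_pmf (case t of 0 \<Rightarrow> return_pmf s | Suc n \<Rightarrow> T (fst (\<omega> n)) (snd (\<omega> n)))
        (\<lambda>s'. map_pmf (Pair s') (\<pi> s')))"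

lemma Ionescu_Tulcea_step_kernel:
  "Ionescu_Tulcea (step_kernel T \<pi> s) (\<lambda>_. count_space UNIV)"
proof (rule Ionescu_Tulcea.intro)
  fix i :: nat
  let ?M = "\<lambda>_::nat. count_space (UNIV :: ('a \<times> 'b) set)"
  show "step_kernel T \<pi> s i \<in> measurable (PiM {0..<i} ?M) (subprob_algebra (?M i))"
  proof (cases i)
    case 0
    show ?thesis
      unfolding 0 step_kernel_def
      by (auto simp: space_subprob_algebra intro!: measure_pmf.subprob_space_axioms)
  next
    case (Suc n)
    define g where "g x = measure_pmf
      (bind_pmf (T (fst x) (snd x)) (\<lambda>s'. map_pmf (Pair s') (\<pi> s')))" for x
    have "(\<lambda>\<omega>. \<omega> n) \<in> measurable (PiM {0..<i} ?M) (?M n)"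
      by (rule measurable_component_singleton) (simp add: Suc)
    moreover have "g \<in> measurable (?M n) (subprob_algebra (?M i))"
      by (auto simp: g_def space_subprob_algebra intro!: measure_pmf.subprob_space_axioms)
    ultimately have "(\<lambda>\<omega>. g (\<omega> n)) \<in> measurable (PiM {0..<i} ?M) (subprob_algebra (?M i))"
      by (rule measurable_compose)
    then show ?thesis
      by (simp add: step_kernel_def[abs_def] g_def Suc)
  qed
qed (auto simp only: step_kernel_def intro!: measure_pmf.prob_space_axioms)

text \<open>The law of the trajectory $(S_t, A_t)_{t \ge 0}$ under $P^\pi_s$, given by the Ionescu-Tulcea
  theorem.\<close>

definition trajectory ::
  "('s::finite \<Rightarrow> 'a::finite \<Rightarrow> 's pmf) \<Rightarrow> ('s \<Rightarrow> 'a pmf) \<Rightarrow> 's \<Rightarrow> (nat \<Rightarrow> 's \<times> 'a) measure" where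
  "trajectory T \<pi> s =
     projective_family.lim UNIV (Ionescu_Tulcea.CI (step_kernel T \<pi> s) (\<lambda>_. count_space UNIV))
       (\<lambda>_. count_space UNIV)"

lemma prob_space_trajectory: "prob_space (trajectory T \<pi> s)"
  and sets_trajectory: "sets (trajectory T \<pi> s) = sets (PiM UNIV (\<lambda>_. count_space UNIV))"
proof -
  interpret Ionescu_Tulcea "step_kernel T \<pi> s" "\<lambda>_. count_space UNIV"
    by (rule Ionescu_Tulcea_step_kernel)
  have [simp]: "(\<lambda>x. restrict x {}) -` {\<lambda>_. undefined} = (UNIV :: (nat \<Rightarrow> 'a \<times> 'b) set)"
    by (auto simp: restrict_def)
  have "emeasure PF.lim (space PF.lim) = 1"
    using lim[of "{}" "{\<lambda>_. undefined}"] prob_space.emeasure_space_1[OF PF.prob_space_P[of "{}"]]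
    by (simp add: PF.space_P space_PiM PF.space_lim prod_emb_def PiM_empty)
  then show "prob_space (trajectory T \<pi> s)"
    unfolding trajectory_def by (rule prob_spaceI)
  show "sets (trajectory T \<pi> s) = sets (PiM UNIV (\<lambda>_. count_space UNIV))"
    unfolding trajectory_def by (rule PF.sets_lim)
qed

text \<open>Actions with $\pi(a|s) = 0$ are almost surely never taken, so the value of \<open>ln 0\<close> is
  irrelevant. As \<open>'s\<close> and \<open>'a\<close> are finite, the summands are bounded up to the factor \<open>\<gamma> ^ t\<close>, so for
  \<open>0 \<le> \<gamma> < 1\<close> the series converges and the integrand is integrable.\<close>

definition regularized_value ::
  "('s::finite \<Rightarrow> 'a::finite \<Rightarrow> 's pmf) \<Rightarrow> ('s \<Rightarrow> 'a \<Rightarrow> real) \<Rightarrow> real \<Rightarrow> real \<Rightarrow> ('s \<Rightarrow> 'a pmf) \<Rightarrow>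
     's \<Rightarrow> real" where
  "regularized_value T f \<gamma> lam \<pi> s =
     (LINT \<omega> | trajectory T \<pi> s.
        (\<Sum>t. \<gamma> ^ t * (case \<omega> t of (s', a) \<Rightarrow> f s' a - lam * ln (pmf (\<pi> s') a))))"

text \<open>The policy attains the maximum over all policies from every initial state, that is,
  its value function is $V^*_\lambda$.\<close>

definition regularized_optimal_policy ::
  "('s::finite \<Rightarrow> 'a::finite \<Rightarrow> 's pmf) \<Rightarrow> ('s \<Rightarrow> 'a \<Rightarrow> real) \<Rightarrow> real \<Rightarrow> real \<Rightarrow> ('s \<Rightarrow> 'a pmf) \<Rightarrow>
     bool" where
  "regularized_optimal_policy T f \<gamma> lam \<pi> \<longleftrightarrow>
     (\<forall>s \<pi>'. regularized_value T f \<gamma> lam \<pi>' s \<le> regularized_value T f \<gamma> lam \<pi> s)"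

end

theory Submission
  imports Defs
begin

text \<open>The heart of the matter is that an optimal policy determines the reward up to shaping by its
  value function \<open>V\<close>: $f(s,a) = \lambda \log \pi(a|s) + V(s) - \gamma \sum_{s'} T(s'|s,a) V(s')$.
  To see this, compare \<open>\<pi>\<close> with the Boltzmann policy \<open>\<sigma>\<close> of the action values of \<open>\<pi>\<close>. The Gibbs
  variational principle gives \<open>\<sigma>\<close> a one-step gain over \<open>\<pi>\<close> that is positive unless \<open>\<sigma> = \<pi>\<close>, and by
  the Bellman equation the gain of value is at least the one-step gain.
  For two rewards the differences \<open>w\<close>, \<open>w'\<close> of the value functions of the two agents then satisfy
  the value-distinguishing hypothesis, both sides being \<open>f\<^sub>1 - f\<^sub>2\<close>.\<close>

subsection \<open>Law of the state-action process\<close>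

text \<open>The recursion peels off the first transition, the form in which the Bellman equation
  uses it.\<close>

primrec state_action_law ::
  "('s::finite \<Rightarrow> 'a::finite \<Rightarrow> 's pmf) \<Rightarrow> ('s \<Rightarrow> 'a pmf) \<Rightarrow> nat \<Rightarrow> 's \<Rightarrow> ('s \<times> 'a) pmf" where
  "state_action_law T \<pi> 0 s = map_pmf (Pair s) (\<pi> s)"
| "state_action_law T \<pi> (Suc t) s =
     bind_pmf (\<pi> s) (\<lambda>a. bind_pmf (T s a) (state_action_law T \<pi> t))"

text \<open>Trajectories grow at their last step, whereas the recursion unfolds the first;
  associativity of bind reconciles the two.\<close>

lemma state_action_law_Suc_last:
  "state_action_law T \<pi> (Suc t) s =
     bind_pmf (state_action_law T \<pi> t s)
       (\<lambda>x. bind_pmf (T (fst x) (snd x)) (\<lambda>s'. map_pmf (Pair s') (\<pi> s')))"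
proof (induction t arbitrary: s)
  case 0
  show ?case
    by (simp add: bind_map_pmf cong: bind_pmf_cong)
next
  case (Suc t)
  have "state_action_law T \<pi> (Suc (Suc t)) s =
      bind_pmf (\<pi> s) (\<lambda>a. bind_pmf (T s a) (state_action_law T \<pi> (Suc t)))"
    by (rule state_action_law.simps)
  also have "\<dots> = bind_pmf (\<pi> s) (\<lambda>a. bind_pmf (T s a) (\<lambda>s'. bind_pmf (state_action_law T \<pi> t s')
       (\<lambda>x. bind_pmf (T (fst x) (snd x)) (\<lambda>s'. map_pmf (Pair s') (\<pi> s')))))"
    unfolding Suc.IH[abs_def] ..
  also have "\<dots> = bind_pmf (state_action_law T \<pi> (Suc t) s)
       (\<lambda>x. bind_pmf (T (fst x) (snd x)) (\<lambda>s'. map_pmf (Pair s') (\<pi> s')))"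
    by (simp add: bind_assoc_pmf)
  finally show ?case .
qed

text \<open>Coordinate \<open>t\<close> is fixed by the first \<open>Suc t\<close> kernels, so the
  projective limit can be replaced by their finite composition, whose last marginal is computed by
  induction.\<close>

lemma distr_trajectory:
  "distr (trajectory T \<pi> s) (count_space UNIV) (\<lambda>\<omega>. \<omega> t) = measure_pmf (state_action_law T \<pi> t s)"
proof -
  let ?N = "count_space (UNIV :: ('a \<times> 'b) set)"
  let ?M = "\<lambda>_::nat. ?N"
  interpret Ionescu_Tulcea "step_kernel T \<pi> s" ?M
    by (rule Ionescu_Tulcea_step_kernel)
  let ?C = "\<lambda>t. C 0 t (\<lambda>_. undefined)"
  have space_0: "(\<lambda>_. undefined) \<in> space (PiM {0..<0} ?M)"
    by (simp add: space_PiM)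
  have nonempty: "space (?C t) \<noteq> {}" for t
    using prob_space_C[OF space_0] by (rule prob_space.not_empty)
  have component: "(\<lambda>\<omega>. \<omega> t) \<in> measurable (PiM {0..<Suc t} ?M) ?N" for t
    by (rule measurable_component_singleton) simp
  have C_measurable: "measurable (?C t) K = measurable (PiM {0..<t} ?M) K" for t and K :: "'c measure"
    using sets_C[OF space_0, of t] by (intro measurable_cong_sets) auto
  \<comment> \<open>\<open>eP t \<omega>\<close> appends one sample of the kernel to the history
    \<omega>, so its newest coordinate has the law of the kernel itself.\<close>
  have last: "distr (?C (Suc t)) ?N (\<lambda>\<omega>. \<omega> t) = ?C t \<bind> step_kernel T \<pi> s t" for t
  proof -
    have "distr (?C (Suc t)) ?N (\<lambda>\<omega>. \<omega> t) = ?C t \<bind> (\<lambda>\<omega>. distr (eP t \<omega>) ?N (\<lambda>\<omega>. \<omega> t))"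
      using measurable_eP[of t] nonempty[of t] component[of t]
      by (simp add: C_measurable distr_bind[where K = "PiM {0..<Suc t} ?M"])
    also have "\<dots> = ?C t \<bind> step_kernel T \<pi> s t"
    proof (rule bind_cong[OF refl])
      fix \<omega> assume "\<omega> \<in> space (?C t)"
      then have \<omega>: "\<omega> \<in> space (PiM {0..<t} ?M)"
        using space_C[OF space_0, of t] by simp
      have "(\<lambda>x. fun_upd \<omega> t x) \<in> measurable (step_kernel T \<pi> s t \<omega>) (PiM {0..<Suc t} ?M)"
        using \<omega> by (intro measurable_fun_upd[where J = "{0..<t}"])
          (auto simp: step_kernel_def)
      then have "distr (eP t \<omega>) ?N (\<lambda>\<omega>. \<omega> t) = distr (step_kernel T \<pi> s t \<omega>) ?N (\<lambda>x. x)"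
        unfolding eP_def by (subst distr_distr[OF component]) (auto simp: comp_def)
      also have "\<dots> = step_kernel T \<pi> s t \<omega>"
        by (rule distr_id2) (simp add: step_kernel_def)
      finally show "distr (eP t \<omega>) ?N (\<lambda>\<omega>. \<omega> t) = step_kernel T \<pi> s t \<omega>" .
    qed
    finally show ?thesis .
  qed
  have C_law: "distr (?C (Suc t)) ?N (\<lambda>\<omega>. \<omega> t) = measure_pmf (state_action_law T \<pi> t s)" for t
  proof (induction t)
    case 0
    have "distr (?C (Suc 0)) ?N (\<lambda>\<omega>. \<omega> 0) = step_kernel T \<pi> s 0 (\<lambda>_. undefined)"
      unfolding last using bind_return[OF P[of 0] space_0] by simp
    also have "\<dots> = measure_pmf (state_action_law T \<pi> 0 s)"
      by (simp add: step_kernel_def bind_return_pmf)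
    finally show ?case .
  next
    case (Suc t)
    \<comment> \<open>Markov property: after time 0 the kernel sees the history only through its
      last pair, so the bind over histories factors through the marginal at
      \<open>t\<close>.\<close>
    define g where "g x = measure_pmf
      (bind_pmf (T (fst x) (snd x)) (\<lambda>s'. map_pmf (Pair s') (\<pi> s')))" for x
    have g: "g \<in> measurable ?N (subprob_algebra ?N)"
      by (auto simp: g_def space_subprob_algebra intro!: measure_pmf.subprob_space_axioms)
    have "distr (?C (Suc (Suc t))) ?N (\<lambda>\<omega>. \<omega> (Suc t)) = ?C (Suc t) \<bind> (\<lambda>\<omega>. g (\<omega> t))"
      unfolding last by (simp add: step_kernel_def[abs_def] g_def)
    also have "\<dots> = distr (?C (Suc t)) ?N (\<lambda>\<omega>. \<omega> t) \<bind> g"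
      using component[of t] nonempty[of "Suc t"]
      by (intro bind_distr[symmetric, OF _ g]) (auto simp: C_measurable simp del: C.simps)
    also have "\<dots> = measure_pmf (state_action_law T \<pi> (Suc t) s)"
      unfolding Suc state_action_law_Suc_last measure_pmf_bind g_def ..
    finally show ?case .
  qed
  let ?J = "{0..<Suc t}"
  \<comment> \<open>\<open>CI ?J\<close> is a restriction of the composition of the first
    \<open>up_to ?J\<close> kernels; for this initial segment that is exactly
    \<open>?C (Suc t)\<close>.\<close>
  have up_to: "up_to ?J = Suc t"
    by (rule antisym) (auto simp: up_to_iff Suc_le_eq intro!: up_to_less)
  have restrict: "(\<lambda>\<omega>. restrict \<omega> ?J) \<in> measurable PF.lim (PiM ?J ?M)"
    by (auto simp: measurable_cong_sets[OF PF.sets_lim refl] intro!: measurable_restrict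
        measurable_component_singleton)
  have restrict_C: "(\<lambda>\<omega>. restrict \<omega> ?J) \<in> measurable (?C (Suc t)) (PiM ?J ?M)"
    unfolding C_measurable by (auto intro!: measurable_restrict measurable_component_singleton)
  have "distr PF.lim ?N (\<lambda>\<omega>. \<omega> t) =
      distr (distr PF.lim (PiM ?J ?M) (\<lambda>\<omega>. restrict \<omega> ?J)) ?N (\<lambda>\<omega>. \<omega> t)"
    by (subst distr_distr[OF component restrict]) (simp add: comp_def)
  also have "\<dots> = distr (CI ?J) ?N (\<lambda>\<omega>. \<omega> t)"
    by (subst distr_lim) auto
  also have "\<dots> = distr (?C (Suc t)) ?N (\<lambda>\<omega>. \<omega> t)"
    unfolding CI_def up_to
    by (subst distr_distr[OF component restrict_C]) (simp add: comp_def)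
  also have "\<dots> = measure_pmf (state_action_law T \<pi> t s)"
    by (rule C_law)
  finally show ?thesis
    unfolding trajectory_def .
qed

lemma
  fixes h :: "'s::finite \<times> 'a::finite \<Rightarrow> real"
  shows integrable_trajectory: "integrable (trajectory T \<pi> s) (\<lambda>\<omega>. h (\<omega> t))"
    and integral_trajectory: "(LINT \<omega> | trajectory T \<pi> s. h (\<omega> t)) =
      measure_pmf.expectation (state_action_law T \<pi> t s) h"
proof -
  have *: "(\<lambda>\<omega>. \<omega> t) \<in> measurable (trajectory T \<pi> s) (count_space UNIV)"
    unfolding measurable_cong_sets[OF sets_trajectory refl]
    by (rule measurable_component_singleton) simp
  show "integrable (trajectory T \<pi> s) (\<lambda>\<omega>. h (\<omega> t))"
    using integrable_distr_eq[OF *, of h]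
    by (simp add: distr_trajectory integrable_measure_pmf_finite)
  show "(LINT \<omega> | trajectory T \<pi> s. h (\<omega> t)) =
      measure_pmf.expectation (state_action_law T \<pi> t s) h"
    using integral_distr[OF *, of h] by (simp add: distr_trajectory)
qed

subsection \<open>Bellman equation\<close>

text \<open>On a finite space \<open>h\<close> is bounded, so a geometric series dominates and sum
  and integral may be exchanged. Values then depend on one-time marginals only.\<close>

lemma discounted_sum_trajectory:
  fixes h :: "'s::finite \<times> 'a::finite \<Rightarrow> real"
  assumes "0 \<le> \<gamma>" "\<gamma> < 1"
  shows "(\<lambda>t. \<gamma> ^ t * measure_pmf.expectation (state_action_law T \<pi> t s) h) sums
    (LINT \<omega> | trajectory T \<pi> s. (\<Sum>t. \<gamma> ^ t * h (\<omega> t)))"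
proof -
  let ?B = "Max (range (\<lambda>x. \<bar>h x\<bar>))"
  have B: "\<bar>h x\<bar> \<le> ?B" for x
    by (intro Max_ge) auto
  have geometric: "summable (\<lambda>t. \<gamma> ^ t * ?B)"
    using assms by (intro summable_mult2 summable_geometric) simp
  have bound: "\<bar>\<gamma> ^ t * x\<bar> \<le> \<gamma> ^ t * ?B" if "\<bar>x\<bar> \<le> ?B" for t x
    using that assms by (simp add: abs_mult mult_left_mono)
  have "(\<lambda>t. LINT \<omega> | trajectory T \<pi> s. \<gamma> ^ t * h (\<omega> t)) sums
    (LINT \<omega> | trajectory T \<pi> s. (\<Sum>t. \<gamma> ^ t * h (\<omega> t)))"
  proof (rule sums_integral)
    show "integrable (trajectory T \<pi> s) (\<lambda>\<omega>. \<gamma> ^ t * h (\<omega> t))" for t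
      by (intro integrable_mult_right integrable_trajectory)
    show "AE \<omega> in trajectory T \<pi> s. summable (\<lambda>t. norm (\<gamma> ^ t * h (\<omega> t)))"
      using bound B by (intro AE_I2 summable_comparison_test[OF _ geometric]) auto
    have "norm (LINT \<omega> | trajectory T \<pi> s. norm (\<gamma> ^ t * h (\<omega> t))) \<le> \<gamma> ^ t * ?B" for t
    proof -
      interpret prob_space "trajectory T \<pi> s"
        by (rule prob_space_trajectory)
      have "(LINT \<omega> | trajectory T \<pi> s. norm (\<gamma> ^ t * h (\<omega> t))) \<le> \<gamma> ^ t * ?B"
        using bound B
        by (intro integral_le_const integrable_norm integrable_mult_right integrable_trajectory) auto
      then show ?thesis
        by simp
    qed
    then show "summable (\<lambda>t. LINT \<omega> | trajectory T \<pi> s. norm (\<gamma> ^ t * h (\<omega> t)))"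
      by (intro summable_comparison_test[OF _ geometric]) auto
  qed
  then show ?thesis
    by (simp add: integral_trajectory)
qed

lemma regularized_value_Bellman:
  fixes T :: "'s::finite \<Rightarrow> 'a::finite \<Rightarrow> 's pmf" and f :: "'s \<Rightarrow> 'a \<Rightarrow> real"
    and \<gamma> lam :: real and \<pi> :: "'s \<Rightarrow> 'a pmf"
  assumes "0 \<le> \<gamma>" "\<gamma> < 1"
  defines "V \<equiv> regularized_value T f \<gamma> lam \<pi>"
  shows "V s = (\<Sum>a\<in>UNIV. pmf (\<pi> s) a *
    (f s a - lam * ln (pmf (\<pi> s) a) + \<gamma> * (\<Sum>s'\<in>UNIV. pmf (T s a) s' * V s')))"
proof -
  define h where "h = (\<lambda>(s', a). f s' a - lam * ln (pmf (\<pi> s') a))"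
  define E where "E t s = measure_pmf.expectation (state_action_law T \<pi> t s) h" for t s
  have V: "(\<lambda>t. \<gamma> ^ t * E t s) sums V s" for s
    using discounted_sum_trajectory[OF assms(1,2), of T \<pi> s h]
    unfolding V_def regularized_value_def E_def h_def .
  have E_0: "E 0 s = (\<Sum>a\<in>UNIV. pmf (\<pi> s) a * h (s, a))"
    by (simp add: E_def integral_measure_pmf[of UNIV])
  have E_Suc: "E (Suc t) s =
      (\<Sum>a\<in>UNIV. pmf (\<pi> s) a * (\<Sum>s'\<in>UNIV. pmf (T s a) s' * E t s'))" for t
    by (simp add: E_def pmf_expectation_bind[of UNIV])
  \<comment> \<open>The discounted transition average of the series for the values at the next state
    is the series for \<open>V s\<close> without its term at time 0.\<close>
  have "(\<lambda>t. \<gamma> * (\<Sum>a\<in>UNIV. pmf (\<pi> s) a * (\<Sum>s'\<in>UNIV. pmf (T s a) s' * (\<gamma> ^ t * E t s')))) sums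
      (\<gamma> * (\<Sum>a\<in>UNIV. pmf (\<pi> s) a * (\<Sum>s'\<in>UNIV. pmf (T s a) s' * V s')))"
    by (intro sums_mult sums_sum V)
  then have "(\<lambda>t. \<gamma> ^ Suc t * E (Suc t) s) sums
      (\<gamma> * (\<Sum>a\<in>UNIV. pmf (\<pi> s) a * (\<Sum>s'\<in>UNIV. pmf (T s a) s' * V s')))"
    by (simp add: E_Suc sum_distrib_left mult_ac)
  then have "(\<lambda>t. \<gamma> ^ t * E t s) sums
      (\<gamma> * (\<Sum>a\<in>UNIV. pmf (\<pi> s) a * (\<Sum>s'\<in>UNIV. pmf (T s a) s' * V s')) + \<gamma> ^ 0 * E 0 s)"
    by (subst (asm) sums_Suc_iff) simp
  then have "V s = \<gamma> * (\<Sum>a\<in>UNIV. pmf (\<pi> s) a * (\<Sum>s'\<in>UNIV. pmf (T s a) s' * V s')) + E 0 s"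
    using sums_unique2[OF V] by simp
  then show ?thesis
    by (simp add: E_0 h_def sum.distrib sum_subtractf sum_distrib_left algebra_simps)
qed

subsection \<open>Gibbs variational principle\<close>

definition boltzmann :: "real \<Rightarrow> ('a::finite \<Rightarrow> real) \<Rightarrow> 'a pmf" where
  "boltzmann lam q = embed_pmf (\<lambda>a. exp (q a / lam) / (\<Sum>b\<in>UNIV. exp (q b / lam)))"

lemma sum_exp_pos: "0 < (\<Sum>b\<in>UNIV. exp (q b :: real))" for q :: "'a::finite \<Rightarrow> real"
  by (intro sum_pos) auto

lemma pmf_boltzmann:
  "pmf (boltzmann lam q) a = exp (q a / lam) / (\<Sum>b\<in>UNIV. exp (q b / lam))"
  unfolding boltzmann_def
proof (rule pmf_embed_pmf)
  let ?Z = "\<Sum>b\<in>UNIV. exp (q b / lam)"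
  show nonneg: "0 \<le> exp (q a / lam) / ?Z" for a
    using sum_exp_pos[of "\<lambda>b. q b / lam"] by (simp add: less_imp_le)
  have "(\<integral>\<^sup>+a. ennreal (exp (q a / lam) / ?Z) \<partial>count_space UNIV) = ennreal (\<Sum>a\<in>UNIV. exp (q a / lam) / ?Z)"
    using nonneg by (subst nn_integral_count_space_finite) (auto simp: sum_ennreal)
  also have "(\<Sum>a\<in>UNIV. exp (q a / lam) / ?Z) = 1"
    using sum_exp_pos[of "\<lambda>b. q b / lam"] by (simp flip: sum_divide_distrib)
  finally show "(\<integral>\<^sup>+a. ennreal (exp (q a / lam) / ?Z) \<partial>count_space UNIV) = 1"
    by simp
qed

lemma ln_pmf_boltzmann:
  "ln (pmf (boltzmann lam q) a) = q a / lam - ln (\<Sum>b\<in>UNIV. exp (q b / lam))"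
  using sum_exp_pos[of "\<lambda>b. q b / lam"] by (simp add: pmf_boltzmann ln_div)

text \<open>This is ln x \<le> x - 1 at x = r / p, multiplied by \<open>p\<close>, with equality
  only at x = 1. For \<open>p = 0\<close> the left side is 0 whatever \<open>ln 0\<close> is, and
  \<open>0 < r\<close> excludes equality.\<close>

lemma entropy_tangent:
  fixes p r :: real
  assumes "0 \<le> p" "0 < r"
  shows "p * (ln r - ln p) \<le> r - p"
    and "p * (ln r - ln p) = r - p \<Longrightarrow> p = r"
proof -
  show "p * (ln r - ln p) \<le> r - p"
    using ln_diff_le[of r p] assms by (cases "p = 0") (auto simp: field_simps)
  show "p = r" if "p * (ln r - ln p) = r - p"
    using ln_eq_minus_one[of "r / p"] that assms by (cases "p = 0") (auto simp: ln_div field_simps)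
qed

text \<open>\<open>F p\<close> is the log-partition value minus \<open>lam\<close> times the
  relative entropy of \<open>p\<close> with respect to the Boltzmann law, which is nonnegative and
  vanishes only at that law.\<close>

lemma gibbs_variational:
  fixes q :: "'a::finite \<Rightarrow> real"
  assumes "0 < lam"
  defines "F \<equiv> \<lambda>p. \<Sum>a\<in>UNIV. pmf p a * (q a - lam * ln (pmf p a))"
  shows "F (boltzmann lam q) = lam * ln (\<Sum>b\<in>UNIV. exp (q b / lam))"
    and "F p \<le> F (boltzmann lam q)"
    and "F p = F (boltzmann lam q) \<Longrightarrow> p = boltzmann lam q"
proof -
  let ?r = "\<lambda>a. pmf (boltzmann lam q) a" and ?L = "ln (\<Sum>b\<in>UNIV. exp (q b / lam))"
  have sum_pmf: "(\<Sum>a\<in>UNIV. pmf p a) = 1" for p :: "'a pmf"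
    by (simp add: sum_pmf_eq_1)
  have r_pos: "0 < ?r a" for a
    using sum_exp_pos[of "\<lambda>b. q b / lam"] by (simp add: pmf_boltzmann)
  have q: "q a = lam * ln (?r a) + lam * ?L" for a
    using assms by (simp add: ln_pmf_boltzmann right_diff_distrib)
  \<comment> \<open>The sum on the right is minus the relative entropy.\<close>
  have F: "F p = lam * ?L + lam * (\<Sum>a\<in>UNIV. pmf p a * (ln (?r a) - ln (pmf p a)))" for p
  proof -
    have "F p = (\<Sum>a\<in>UNIV. lam * ?L * pmf p a + lam * (pmf p a * (ln (?r a) - ln (pmf p a))))"
      unfolding F_def by (intro sum.cong refl) (subst q, simp add: algebra_simps)
    then show ?thesis
      by (simp add: sum.distrib sum_pmf flip: sum_distrib_left)
  qed
  show F_r: "F (boltzmann lam q) = lam * ?L"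
    by (simp add: F)
  have le: "pmf p a * (ln (?r a) - ln (pmf p a)) \<le> ?r a - pmf p a" for a
    using r_pos by (intro entropy_tangent) auto
  have sum_diff: "(\<Sum>a\<in>UNIV. ?r a - pmf p a) = 0"
    by (simp add: sum_subtractf sum_pmf)
  have "(\<Sum>a\<in>UNIV. pmf p a * (ln (?r a) - ln (pmf p a))) \<le> (\<Sum>a\<in>UNIV. ?r a - pmf p a)"
    by (intro sum_mono le)
  then show "F p \<le> F (boltzmann lam q)"
    using assms unfolding F_r F[of p] sum_diff by (simp add: mult_nonneg_nonpos)
  assume "F p = F (boltzmann lam q)"
  then have "(\<Sum>a\<in>UNIV. pmf p a * (ln (?r a) - ln (pmf p a))) = (\<Sum>a\<in>UNIV. ?r a - pmf p a)"
    using assms unfolding F_r F[of p] sum_diff by simp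
  \<comment> \<open>Equal sums under a termwise inequality force equality in every term.\<close>
  then have "pmf p a * (ln (?r a) - ln (pmf p a)) = ?r a - pmf p a" for a
    by (rule sum_mono_inv) (auto intro: le)
  then show "p = boltzmann lam q"
    using r_pos entropy_tangent(2)[of "pmf p a" "?r a" for a] by (intro pmf_eqI) simp
qed

subsection \<open>Optimal policies\<close>

text \<open>Minimum principle: at a minimizer of \<open>D\<close> with minimum m the equation gives
  m \<ge> \<gamma> m, hence m \<ge> 0, so the discounted average only adds to \<open>g s\<close>.
  Applied with \<open>D\<close> the gain of value and \<open>g\<close> the one-step gain.\<close>

lemma discounted_supersolution_ge:
  fixes D :: "'s::finite \<Rightarrow> real"
  assumes "0 \<le> \<gamma>" "\<gamma> < 1"
    and "\<And>s. 0 \<le> g s"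
    and D: "\<And>s. D s = g s + \<gamma> * measure_pmf.expectation (K s) D"
  shows "g s \<le> D s"
proof -
  have int: "integrable (measure_pmf p) D" for p
    by (simp add: integrable_measure_pmf_finite)
  let ?m = "Min (range D)"
  have ge: "?m \<le> measure_pmf.expectation (K s) D" for s
    using int by (intro measure_pmf.integral_ge_const) (auto intro!: AE_I2 Min_le)
  obtain s0 where "?m = D s0"
    using Min_in[of "range D"] by (metis finite finite_imageI image_is_empty UNIV_not_empty rangeE)
  then have "\<gamma> * ?m \<le> ?m"
    using D[of s0] mult_left_mono[OF ge[of s0] assms(1)] assms(3)[of s0] by simp
  then have "0 \<le> (1 - \<gamma>) * ?m"
    by (simp add: algebra_simps)
  then have "0 \<le> ?m"
    using assms(2) by (simp add: zero_le_mult_iff)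
  then have "0 \<le> measure_pmf.expectation (K s) D"
    using ge[of s] by simp
  then show ?thesis
    using D[of s] assms(1) by simp
qed

lemma optimal_policy_reward:
  assumes "lam > 0" "0 \<le> \<gamma>" "\<gamma> < 1"
    and opt: "regularized_optimal_policy T f \<gamma> lam \<pi>"
  defines "V \<equiv> regularized_value T f \<gamma> lam \<pi>"
  shows "f s a = lam * ln (pmf (\<pi> s) a) + (V s - \<gamma> * (\<Sum>s'\<in>UNIV. pmf (T s a) s' * V s'))"
proof -
  define Q where "Q s a = f s a + \<gamma> * (\<Sum>s'\<in>UNIV. pmf (T s a) s' * V s')" for s a
  define F where "F s p = (\<Sum>a\<in>UNIV. pmf p a * (Q s a - lam * ln (pmf p a)))" for s p
  define \<sigma> where "\<sigma> s = boltzmann lam (Q s)" for s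
  define W where "W = regularized_value T f \<gamma> lam \<sigma>"
  define g where "g s = F s (\<sigma> s) - F s (\<pi> s)" for s
  have V: "V s = F s (\<pi> s)" for s
    using regularized_value_Bellman[OF assms(2,3), of T f lam \<pi> s]
    by (simp add: F_def Q_def V_def algebra_simps)
  have W: "W s = (\<Sum>a\<in>UNIV. pmf (\<sigma> s) a *
      (f s a - lam * ln (pmf (\<sigma> s) a) + \<gamma> * (\<Sum>s'\<in>UNIV. pmf (T s a) s' * W s')))" for s
    unfolding W_def by (rule regularized_value_Bellman[OF assms(2,3)])
  have "W s - V s = g s + \<gamma> * measure_pmf.expectation (bind_pmf (\<sigma> s) (T s)) (\<lambda>s. W s - V s)" for s
  proof -
    have "W s - V s = g s + (W s - F s (\<sigma> s))"
      by (simp add: g_def V)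
    also have "W s - F s (\<sigma> s) = (\<Sum>a\<in>UNIV. pmf (\<sigma> s) a *
        (\<gamma> * (\<Sum>s'\<in>UNIV. pmf (T s a) s' * (W s' - V s'))))"
      \<comment> \<open>Both terms use \<sigma>, so reward and entropy cancel and only the
        difference of continuation values remains.\<close>
      unfolding W[of s] F_def Q_def sum_subtractf[symmetric] right_diff_distrib
      by (simp add: algebra_simps sum_subtractf)
    also have "\<dots> = \<gamma> * measure_pmf.expectation (bind_pmf (\<sigma> s) (T s)) (\<lambda>s. W s - V s)"
      by (subst pmf_expectation_bind[of UNIV])
        (auto simp: integral_measure_pmf[of UNIV] sum_distrib_left mult_ac)
    finally show ?thesis .
  qed
  moreover have "0 \<le> g s" for s
    unfolding g_def F_def \<sigma>_def using gibbs_variational(2)[OF assms(1)] by simp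
  ultimately have "g s \<le> W s - V s"
    using assms(2,3) by (intro discounted_supersolution_ge[where g = g])
  \<comment> \<open>Optimality of \<pi> squeezes the gain: 0 \<le> \<open>g s\<close> \<le>
    \<open>W s - V s\<close> \<le> 0.\<close>
  moreover have "W s \<le> V s"
    using opt unfolding regularized_optimal_policy_def V_def W_def by blast
  ultimately have "F s (\<pi> s) = F s (\<sigma> s)"
    using \<open>0 \<le> g s\<close> by (simp add: g_def)
  then have "\<pi> s = boltzmann lam (Q s)"
    unfolding F_def \<sigma>_def by (rule gibbs_variational(3)[OF assms(1)])
  \<comment> \<open>The value is thus the log-partition function that normalizes the Boltzmann
    policy, so \<open>lam * ln (pmf (\<pi> s) a)\<close> becomes \<open>Q s a - V s\<close>.\<close>
  moreover from this have "V s = lam * ln (\<Sum>b\<in>UNIV. exp (Q s b / lam))"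
    using gibbs_variational(1)[OF assms(1), of "Q s"] by (simp add: V F_def)
  ultimately have "lam * ln (pmf (\<pi> s) a) = Q s a - V s"
    using assms(1) by (simp add: ln_pmf_boltzmann right_diff_distrib)
  then show ?thesis
    by (simp add: Q_def)
qed

text \<open>Each row of \<open>T\<close> sums to 1, so a constant c is shaped into (1 - \<gamma>)
  c.\<close>

lemma constant_difference_of_shaping:
  fixes w :: "'s::finite \<Rightarrow> real"
  assumes "w constant_on UNIV"
  shows "\<exists>c. \<forall>s a. w s - \<gamma> * (\<Sum>s'\<in>UNIV. pmf (T s a) s' * w s') = c"
proof -
  obtain c where "w = (\<lambda>_. c)"
    using assms by (auto simp: constant_on_def)
  then show ?thesis
    by (simp add: sum_pmf_eq_1 flip: sum_distrib_right)
qed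

theorem theorem2:
  fixes T T' :: "'s::finite \<Rightarrow> 'a::finite \<Rightarrow> 's pmf"
    and \<gamma> \<gamma>' lam :: real
    and \<pi> \<pi>' :: "'s \<Rightarrow> 'a pmf"
    and f\<^sub>1 f\<^sub>2 :: "'s \<Rightarrow> 'a \<Rightarrow> real"
  assumes "lam > 0"
    and "0 \<le> \<gamma>" "\<gamma> < 1"
    and "0 \<le> \<gamma>'" "\<gamma>' < 1"
    and "value_distinguishing \<gamma> T \<gamma>' T'"
    and "regularized_optimal_policy T f\<^sub>1 \<gamma> lam \<pi>"
    and "regularized_optimal_policy T' f\<^sub>1 \<gamma>' lam \<pi>'"
    and "regularized_optimal_policy T f\<^sub>2 \<gamma> lam \<pi>"
    and "regularized_optimal_policy T' f\<^sub>2 \<gamma>' lam \<pi>'"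
  shows "\<exists>c. \<forall>s a. f\<^sub>1 s a - f\<^sub>2 s a = c"
proof -
  define w where "w s = regularized_value T f\<^sub>1 \<gamma> lam \<pi> s - regularized_value T f\<^sub>2 \<gamma> lam \<pi> s" for s
  define w' where
    "w' s = regularized_value T' f\<^sub>1 \<gamma>' lam \<pi>' s - regularized_value T' f\<^sub>2 \<gamma>' lam \<pi>' s" for s
  \<comment> \<open>The same policy is optimal for both rewards, so its logarithm cancels on
    subtraction and only the shaping term of \<open>w\<close> is left.\<close>
  have w: "f\<^sub>1 s a - f\<^sub>2 s a = w s - \<gamma> * (\<Sum>s'\<in>UNIV. pmf (T s a) s' * w s')" for s a
    using optimal_policy_reward[OF assms(1-3) assms(7), of s a]
      optimal_policy_reward[OF assms(1-3) assms(9), of s a]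
    by (simp add: w_def algebra_simps sum_subtractf)
  have w': "f\<^sub>1 s a - f\<^sub>2 s a = w' s - \<gamma>' * (\<Sum>s'\<in>UNIV. pmf (T' s a) s' * w' s')" for s a
    using optimal_policy_reward[OF assms(1) assms(4,5) assms(8), of s a]
      optimal_policy_reward[OF assms(1) assms(4,5) assms(10), of s a]
    by (simp add: w'_def algebra_simps sum_subtractf)
  have "w constant_on UNIV \<or> w' constant_on UNIV"
    using assms(6) w w' unfolding value_distinguishing_def by metis
  then show ?thesis
  proof
    assume "w constant_on UNIV"
    then show ?thesis
      unfolding w by (rule constant_difference_of_shaping)
  next
    assume "w' constant_on UNIV"
    then show ?thesis
      unfolding w' by (rule constant_difference_of_shaping)
  qed
qed

end
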